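(* Let $e_{\mathbb R}$ be a fixed even integer with $-18\le e_{\mathbb R}\le 20$, and let $(w_g)_{g\ge 0}$ be the corresponding sequence of signed counts of real rational curves on primitively polarized real $K3$ surfaces whose real part has Euler characteristic $e_{\mathbb R}$. (1) If $e_{\mathbb R}<0$, then all $w_g$ are positive and they form a strictly increasing sequence $|e_{\mathbb R}|=w_1<w_2<w_3<\dots$. (2) If $e_{\mathbb R}=0$, then $w_g=0$ for all odd $g$, while all $w_g$ with even $g$ are positive and form a strictly increasing sequence $12=w_2<w_4<\dots$. (3) If $e_{\mathbb R}>0$, then all the terms of the sequence $(-1)^g w_g$ are positive and they form a strictly increasing sequence $e_{\mathbb R}=-w_1<w_2<-w_3<\dots$.
   Context: Let $X$ be a generic real $K3$ surface admitting a complete real $g$-dimensional linear system of curves of genus $g$; if $g\ge 2$, assume in addition that $X$ has Picard rank $1$ and that the curves in the linear system belong to a primitive divisor class. Genericity ensures that all rational curves in the linear system are nodal. Let $w_g=n_+-n_-$ be the number of real rational curves in this linear system counted with Welschinger sign: $n_+$ (resp. $n_-$) is the number of real rational curves in the system having an even (resp. odd) number of real solitary points. Let $e_{\mathbb R}$ be the Euler characteristic of the real part $X_{\mathbb R}$; it is always even and varies between $-18$ and $20$. It is a known result (taken as given) that $w_g$ depends only on $g$ and $e_{\mathbb R}$, and that for fixed $e_{\mathbb R}$, with $e_{\mathbb C}=24$, $$\sum_{g\ge 0} w_g q^g=\prod_{r\ge 1}\frac{1}{(1+q^r)^{e_{\mathbb R}}}\prod_{s\ge 1}\frac{1}{(1-q^{2s})^{\frac{e_{\mathbb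 C}-e_{\mathbb R}}{2}}}.$$ For fixed $e_{\mathbb R}$, $(w_g)_{g\ge0}$ denotes the sequence of coefficients of this series. *)

theory Defs
  imports
    "HOL-Computational_Algebra.Formal_Power_Series"
    "HOL-Analysis.Infinite_Products"
begin

text \<open>
  The argument \<open>e\<close> is the Euler characteristic of the real part of the K3 surface. Infinite
  products are taken in the metric topology of formal power series (coefficientwise
  stabilisation), with indices $r, s \ge 1$ shifted to start at 0. Since \<open>e\<close> may be
  negative, exponents are integers; rational coefficients make the library inverse of power
  series available.
\<close>

definition e_complex :: int where
  "e_complex = 24"

definition welschinger_series :: "int \<Rightarrow> rat fps" where
  "welschinger_series e =
     (\<Prod>r. 1 / ((1 + fps_X ^ Suc r) powi e)) *
     (\<Prod>s. 1 / ((1 - fps_X ^ (2 * Suc s)) powi ((e_complex - e) div 2)))"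

definition welschinger_count :: "int \<Rightarrow> nat \<Rightarrow> rat" where
  "welschinger_count e g = fps_nth (welschinger_series e) g"

end

theory Submission
  imports Defs
begin

text \<open>
  Write \<open>c\<close> for the sign \<open>1\<close> if \<open>e < 0\<close> and \<open>- 1\<close> if \<open>e > 0\<close>, and \<open>W\<close> for the generating series. The claim
  for \<open>e \<noteq> 0\<close> is that the signed coefficients \<open>c ^ g * w g\<close> are positive and strictly increasing.
  Everything comes from the first factors of the product. For \<open>e < 0\<close> the product
  contains \<open>(1 + q)\<^sup>2\<close>, as \<open>- e \<ge> 2\<close>, and \<open>1 / (1 - q\<^sup>2)\<^sup>2\<close>, and all remaining factors have
  nonnegative coefficients. Since
    \<open>(1 - q) * (1 + q)\<^sup>2 / (1 - q\<^sup>2)\<^sup>2 = 1 / (1 - q)\<close>,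
  the series \<open>(1 - q) * W\<close>, whose coefficients are the differences of consecutive counts, is
  \<open>1 / (1 - q)\<close> times a series with constant term \<open>1\<close> and nonnegative coefficients. Hence every
  difference is at least \<open>1\<close>.

  For \<open>e > 0\<close> the factors \<open>(1 + q ^ r) ^ (- e)\<close> with even \<open>r\<close> have coefficients of both signs, and
  they keep them when \<open>- q\<close> is substituted for \<open>q\<close>. Euler's identity
    \<open>\<Prod> (1 + q ^ r) * \<Prod> (1 - q ^ (2 * n + 1)) = 1\<close>
  (as many partitions into distinct parts as into odd parts) turns their product into
  \<open>\<Prod> (1 - q ^ (2 * n + 1)) ^ e\<close>. Now only odd powers of \<open>q\<close> carry a minus sign, so all factors
  have nonnegative coefficients up to the sign \<open>(- 1) ^ g\<close>, and the previous argument applies with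
  \<open>- q\<close> in place of \<open>q\<close>. The square \<open>1 / (1 - q\<^sup>2)\<^sup>2\<close> is there because \<open>(24 - e) / 2 \<ge> 2\<close> for
  \<open>e \<le> 20\<close>.

  For \<open>e = 0\<close> only \<open>\<Prod> (1 - q ^ (2 * s)) ^ (- 12)\<close> is left, a series in \<open>q\<^sup>2\<close>, and the
  same argument is run with \<open>1 - q\<^sup>2\<close> in place of \<open>1 - q\<close>.

  The main steps are \<open>Euler_odd_distinct_identity\<close>, \<open>strict_mono_of_square_factor\<close> and
  \<open>signed_product_growth\<close>. The manipulation of the infinite products rests on
  \<open>fps_prodinf_nth\<close>, which identifies each of their coefficients with one of a finite product.
\<close>

section \<open>Infinite products of formal power series\<close>

lemma fps_X_power_dvd_diff_nth:
  fixes f g :: "'a::comm_ring_1 fps"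
  assumes "fps_X ^ m dvd f - g" "i < m"
  shows "fps_nth f i = fps_nth g i"
proof -
  obtain h where "f - g = fps_X ^ m * h" using assms(1) by (elim dvdE)
  hence "fps_nth (f - g) i = 0" using assms(2) by (simp add: fps_X_power_mult_nth)
  thus ?thesis by simp
qed

lemma fps_mult_nth_cong:
  fixes f g :: "'a::comm_ring_1 fps"
  assumes "\<And>j. j \<le> i \<Longrightarrow> fps_nth f j = fps_nth f' j" "\<And>j. j \<le> i \<Longrightarrow> fps_nth g j = fps_nth g' j"
  shows "fps_nth (f * g) i = fps_nth (f' * g') i"
  unfolding fps_mult_nth by (intro sum.cong refl arg_cong2[where f = "(*)"] assms) auto

text \<open>
  The \<open>n\<close>-th factor is \<open>1\<close> up to order \<open>n\<close>, so that multiplying by it leaves the coefficients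
  up to \<open>q ^ n\<close> of a partial product unchanged. All products below have this form, and unlike
  mere convergence it tells at which partial product a given coefficient has settled.
\<close>
definition stable_factors :: "(nat \<Rightarrow> 'a::comm_ring_1 fps) \<Rightarrow> bool" where
  "stable_factors f \<longleftrightarrow> (\<forall>n. fps_X ^ Suc n dvd f n - 1)"

lemma stable_factors_nth_0: "stable_factors f \<Longrightarrow> fps_nth (f n) 0 = 1"
  using fps_X_power_dvd_diff_nth[of "Suc n" "f n" 1 0] by (simp add: stable_factors_def)

lemma stable_factors_one: "stable_factors (\<lambda>n. 1)"
  by (simp add: stable_factors_def)

lemma stable_factors_mult:
  assumes "stable_factors f" "stable_factors g"
  shows "stable_factors (\<lambda>n. f n * g n)"
  unfolding stable_factors_def
proof
  fix n
  have "f n * g n - 1 = (f n - 1) * g n + (g n - 1)" by (simp add: algebra_simps)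
  thus "fps_X ^ Suc n dvd f n * g n - 1"
    using assms unfolding stable_factors_def by (metis dvd_add dvd_mult2)
qed

lemma stable_factors_power: "stable_factors f \<Longrightarrow> stable_factors (\<lambda>n. f n ^ k)"
  by (induction k) (simp_all add: stable_factors_one stable_factors_mult)

lemma stable_factors_inverse:
  fixes f :: "nat \<Rightarrow> 'a::field fps"
  assumes "stable_factors f"
  shows "stable_factors (\<lambda>n. inverse (f n))"
  unfolding stable_factors_def
proof
  fix n
  have "inverse (f n) * f n = 1"
    by (rule inverse_mult_eq_1) (simp add: stable_factors_nth_0[OF assms])
  hence "inverse (f n) - 1 = (f n - 1) * (- inverse (f n))" by (simp add: algebra_simps)
  thus "fps_X ^ Suc n dvd inverse (f n) - 1"
    using assms unfolding stable_factors_def by (metis dvd_mult2)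
qed

lemma stable_factors_Suc:
  assumes "stable_factors f" shows "stable_factors (\<lambda>n. f (Suc n))"
  unfolding stable_factors_def
proof
  fix n
  have "fps_X ^ Suc n dvd (fps_X ^ Suc (Suc n) :: 'a fps)" by (rule le_imp_power_dvd) simp
  also have "\<dots> dvd f (Suc n) - 1" using assms unfolding stable_factors_def by blast
  finally show "fps_X ^ Suc n dvd f (Suc n) - 1" .
qed

lemma stable_factors_one_plus_monomial:
  fixes c :: "'a::comm_ring_1"
  assumes "\<And>n. n < k n"
  shows "stable_factors (\<lambda>n. 1 + fps_const c * fps_X ^ k n)"
  unfolding stable_factors_def
proof
  fix n
  have "fps_X ^ Suc n dvd (fps_X ^ k n :: 'a fps)"
    using assms[of n] by (intro le_imp_power_dvd) simp
  thus "fps_X ^ Suc n dvd 1 + fps_const c * fps_X ^ k n - 1" by simp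
qed

lemmas stable_factors_one_plus = stable_factors_one_plus_monomial[where c = 1, simplified]
lemmas stable_factors_one_minus = stable_factors_one_plus_monomial[where c = "- 1",
    unfolded fps_const_neg[symmetric] fps_const_1_eq_1 mult_minus1 add_uminus_conv_diff]

lemma prod_nth_stable:
  assumes "stable_factors f" "i \<le> N" "N \<le> M"
  shows "fps_nth (\<Prod>n<M. f n) i = fps_nth (\<Prod>n<N. f n) i"
  using assms(3)
proof (induction M rule: dec_induct)
  case (step M)
  have "(\<Prod>n<Suc M. f n) - (\<Prod>n<M. f n) = (f M - 1) * (\<Prod>n<M. f n)"
    by (simp add: algebra_simps)
  hence "fps_X ^ Suc M dvd (\<Prod>n<Suc M. f n) - (\<Prod>n<M. f n)"
    using assms(1) unfolding stable_factors_def by (metis dvd_mult2)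
  hence "fps_nth (\<Prod>n<Suc M. f n) i = fps_nth (\<Prod>n<M. f n) i"
    by (rule fps_X_power_dvd_diff_nth) (use step assms(2) in simp)
  thus ?case using step by simp
qed simp

text \<open>
  The partial products are coefficientwise eventually constant. Their limit has constant term \<open>1\<close>,
  so it is nonzero, as the definition of a convergent infinite product demands. Identities
  between infinite products therefore reduce to identities between finite ones.
\<close>
lemma fps_prodinf_nth:
  fixes f :: "nat \<Rightarrow> 'a::idom fps"
  assumes "stable_factors f" "i \<le> N"
  shows "fps_nth (prodinf f) i = fps_nth (\<Prod>n<N. f n) i"
proof -
  define L where "L = Abs_fps (\<lambda>i. fps_nth (\<Prod>n<i. f n) i)"
  have L: "fps_nth L i = fps_nth (\<Prod>n<N. f n) i" if "i \<le> N" for i N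
    using prod_nth_stable[OF assms(1) order_refl that] by (simp add: L_def)
  have "(\<lambda>n. \<Prod>i\<le>n. f i) \<longlonglongrightarrow> L"
  proof (rule tendsto_fpsI)
    fix i
    show "\<forall>\<^sub>F n in sequentially. fps_nth (\<Prod>i\<le>n. f i) i = fps_nth L i"
      using eventually_ge_at_top[of i]
      by eventually_elim (subst L[of i "Suc n" for n], auto simp: lessThan_Suc_atMost)
  qed
  moreover have "L \<noteq> 0"
    using L[of 0 0] by auto
  ultimately have "f has_prod L" by (simp add: has_prod_def raw_has_prod_def)
  thus ?thesis using has_prod_unique[of f L] L[OF assms(2)] by simp
qed

lemma fps_prodinf_nth_0: "stable_factors f \<Longrightarrow> fps_nth (prodinf f :: 'a::idom fps) 0 = 1"
  by (subst fps_prodinf_nth[of f 0 0]) auto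

lemma fps_prodinf_mult:
  fixes f g :: "nat \<Rightarrow> 'a::idom fps"
  assumes "stable_factors f" "stable_factors g"
  shows "(\<Prod>n. f n * g n) = prodinf f * prodinf g"
proof (rule fps_ext)
  fix i
  have "fps_nth (\<Prod>n. f n * g n) i = fps_nth ((\<Prod>n<i. f n) * (\<Prod>n<i. g n)) i"
    using fps_prodinf_nth[OF stable_factors_mult[OF assms] order_refl] by (simp add: prod.distrib)
  also have "\<dots> = fps_nth (prodinf f * prodinf g) i"
    by (intro fps_mult_nth_cong fps_prodinf_nth[symmetric] assms)
  finally show "fps_nth (\<Prod>n. f n * g n) i = \<dots>" .
qed

lemma fps_prodinf_one: "(\<Prod>n. 1) = (1 :: 'a::idom fps)"
  by (rule fps_ext) (subst fps_prodinf_nth[OF stable_factors_one order_refl], simp)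

lemma fps_prodinf_power:
  fixes f :: "nat \<Rightarrow> 'a::idom fps"
  assumes "stable_factors f"
  shows "(\<Prod>n. f n ^ k) = prodinf f ^ k"
proof (induction k)
  case (Suc k)
  thus ?case using fps_prodinf_mult[OF assms stable_factors_power[OF assms, of k]] by simp
qed (simp add: fps_prodinf_one)

lemma fps_prodinf_split_head:
  fixes f :: "nat \<Rightarrow> 'a::idom fps"
  assumes "stable_factors f"
  shows "prodinf f = f 0 * (\<Prod>n. f (Suc n))"
proof (rule fps_ext)
  fix i
  have "fps_nth (prodinf f) i = fps_nth (\<Prod>n<Suc i. f n) i"
    by (rule fps_prodinf_nth[OF assms]) simp
  also have "\<dots> = fps_nth (f 0 * (\<Prod>n<i. f (Suc n))) i"
    by (simp only: prod.lessThan_Suc_shift)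
  also have "\<dots> = fps_nth (f 0 * (\<Prod>n. f (Suc n))) i"
    by (intro fps_mult_nth_cong refl fps_prodinf_nth[symmetric] stable_factors_Suc assms)
  finally show "fps_nth (prodinf f) i = \<dots>" .
qed

text \<open>
  The reindexing uses that the first \<open>i\<close> even and the first \<open>i\<close> odd positions together make up
  the first \<open>2 * i\<close> positions, which is more than enough for the coefficient of \<open>q ^ i\<close>.
\<close>
lemma fps_prodinf_evens_odds:
  fixes f :: "nat \<Rightarrow> 'a::idom fps"
  assumes "stable_factors f" "stable_factors (\<lambda>n. f (2 * n))" "stable_factors (\<lambda>n. f (2 * n + 1))"
  shows "prodinf f = (\<Prod>n. f (2 * n)) * (\<Prod>n. f (2 * n + 1))"
proof (rule fps_ext)
  fix i
  have *: "(\<Prod>n<2 * i. f n) = (\<Prod>n<i. f (2 * n)) * (\<Prod>n<i. f (2 * n + 1))"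
    by (induction i) (simp_all add: algebra_simps)
  have "fps_nth (prodinf f) i = fps_nth (\<Prod>n<2 * i. f n) i"
    by (rule fps_prodinf_nth[OF assms(1)]) simp
  also have "\<dots> = fps_nth ((\<Prod>n. f (2 * n)) * (\<Prod>n. f (2 * n + 1))) i"
    unfolding * by (intro fps_mult_nth_cong fps_prodinf_nth[symmetric] assms)
  finally show "fps_nth (prodinf f) i = \<dots>" .
qed

section \<open>Euler's identity for odd and distinct parts\<close>

text \<open>
  With \<open>A\<close>, \<open>B\<close>, \<open>C\<close>, \<open>D\<close> the products of \<open>1 + q ^ r\<close>, \<open>1 - q ^ r\<close>, \<open>1 - q ^ (2 * n + 1)\<close> and
  \<open>1 - q ^ (2 * s)\<close>, the factorisation of \<open>1 - q ^ (2 * r)\<close> gives \<open>A * B = D\<close>, and separating odd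
  from even exponents gives \<open>B = C * D\<close>. Thus \<open>A * C * B = C * D = B\<close>, and \<open>B\<close> cancels.
\<close>
lemma Euler_odd_distinct_identity:
  "(\<Prod>n. 1 + fps_X ^ Suc n) * (\<Prod>n. 1 - fps_X ^ (2 * n + 1)) = (1 :: 'a::idom fps)"
proof -
  let ?A = "\<Prod>n. 1 + fps_X ^ Suc n :: 'a fps" and ?B = "\<Prod>n. 1 - fps_X ^ Suc n :: 'a fps"
  let ?C = "\<Prod>n. 1 - fps_X ^ (2 * n + 1) :: 'a fps" and ?D = "\<Prod>n. 1 - fps_X ^ (2 * n + 2) :: 'a fps"
  have "?A * ?B = (\<Prod>n. (1 + fps_X ^ Suc n) * (1 - fps_X ^ Suc n))"
    by (intro fps_prodinf_mult[symmetric] stable_factors_one_plus stable_factors_one_minus) auto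
  also have "(\<lambda>n. (1 + fps_X ^ Suc n) * (1 - fps_X ^ Suc n) :: 'a fps) = (\<lambda>n. 1 - fps_X ^ (2 * n + 2))"
  proof
    fix n
    have "2 * n + 2 = Suc n + Suc n" by simp
    hence "fps_X ^ (2 * n + 2) = (fps_X ^ Suc n * fps_X ^ Suc n :: 'a fps)" by (simp only: power_add)
    thus "(1 + fps_X ^ Suc n) * (1 - fps_X ^ Suc n) = (1 - fps_X ^ (2 * n + 2) :: 'a fps)"
      by (simp only:) (simp only: algebra_simps, simp)
  qed
  finally have AB: "?A * ?B = ?D" .
  have BCD: "?B = ?C * ?D"
    using fps_prodinf_evens_odds[of "\<lambda>n. 1 - fps_X ^ Suc n :: 'a fps"]
    by (simp add: stable_factors_one_minus del: power_Suc)
  have "stable_factors (\<lambda>n. 1 - fps_X ^ Suc n :: 'a fps)"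
    by (intro stable_factors_one_minus) auto
  hence "?B \<noteq> 0" using fps_prodinf_nth_0 by fastforce
  have "(?A * ?C) * ?B = ?C * (?A * ?B)" by (simp only: mult_ac)
  also have "\<dots> = 1 * ?B" unfolding AB using BCD by simp
  finally show ?thesis using \<open>?B \<noteq> 0\<close> by (metis mult_cancel_right)
qed

lemma left_inverse_eq_right_inverse: "a * b = 1 \<Longrightarrow> b * c = 1 \<Longrightarrow> a = (c :: 'a::monoid_mult)"
  by (metis mult.assoc mult_1_left mult_1_right)

text \<open>
  Euler's identity and the termwise cancellation both exhibit an inverse of \<open>\<Prod> (1 + q ^ r)\<close>.
\<close>
lemma prodinf_inverse_one_plus_fps_X_power:
  "(\<Prod>n. inverse (1 + fps_X ^ Suc n)) = (\<Prod>n. 1 - fps_X ^ (2 * n + 1) :: 'a::field fps)"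
proof -
  let ?A = "\<Prod>n. 1 + fps_X ^ Suc n :: 'a fps"
  have st: "stable_factors (\<lambda>n. 1 + fps_X ^ Suc n :: 'a fps)" by (rule stable_factors_one_plus) simp
  have "(\<Prod>n. inverse (1 + fps_X ^ Suc n)) * ?A = (\<Prod>n. inverse (1 + fps_X ^ Suc n) * (1 + fps_X ^ Suc n) :: 'a fps)"
    by (intro fps_prodinf_mult[symmetric] stable_factors_inverse st)
  also have "\<dots> = 1"
    using stable_factors_nth_0[OF st] by (simp add: inverse_mult_eq_1 fps_prodinf_one)
  finally have "(\<Prod>n. inverse (1 + fps_X ^ Suc n)) * ?A = 1" .
  thus ?thesis using Euler_odd_distinct_identity[where 'a = 'a] by (rule left_inverse_eq_right_inverse)
qed

section \<open>Series with coefficients of prescribed sign\<close>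

text \<open>
  For \<open>c = - 1\<close> this says that the series in \<open>- q\<close> has nonnegative coefficients. Keeping \<open>c\<close> as a
  parameter treats both signs of the Euler characteristic at once.
\<close>
definition sign_nonneg :: "'a::linordered_idom \<Rightarrow> 'a fps \<Rightarrow> bool" where
  "sign_nonneg c f \<longleftrightarrow> (\<forall>n. 0 \<le> c ^ n * fps_nth f n)"

lemma sign_nonneg_one: "sign_nonneg c 1"
  by (simp add: sign_nonneg_def)

lemma signed_fps_mult_nth:
  fixes c :: "'a::comm_ring_1"
  shows "c ^ n * fps_nth (f * g) n = (\<Sum>i=0..n. (c ^ i * fps_nth f i) * (c ^ (n - i) * fps_nth g (n - i)))"
  unfolding fps_mult_nth sum_distrib_left
proof (intro sum.cong refl)
  fix i assume "i \<in> {0..n}"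
  hence "c ^ n = c ^ i * c ^ (n - i)" by (simp flip: power_add)
  thus "c ^ n * (fps_nth f i * fps_nth g (n - i)) = (c ^ i * fps_nth f i) * (c ^ (n - i) * fps_nth g (n - i))"
    by (simp add: mult_ac)
qed

lemma sign_nonneg_mult: "sign_nonneg c f \<Longrightarrow> sign_nonneg c g \<Longrightarrow> sign_nonneg c (f * g)"
  unfolding sign_nonneg_def signed_fps_mult_nth by (auto intro!: sum_nonneg)

lemma sign_nonneg_power: "sign_nonneg c f \<Longrightarrow> sign_nonneg c (f ^ k)"
  by (induction k) (simp_all add: sign_nonneg_one sign_nonneg_mult)

lemma sign_nonneg_prodinf:
  assumes "stable_factors f" "\<And>n. sign_nonneg c (f n)"
  shows "sign_nonneg c (prodinf f)"
  unfolding sign_nonneg_def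
proof
  fix i
  have "sign_nonneg c (\<Prod>n<N. f n)" for N
    by (induction N) (simp_all add: sign_nonneg_one sign_nonneg_mult assms(2))
  thus "0 \<le> c ^ i * fps_nth (prodinf f) i"
    using fps_prodinf_nth[OF assms(1), of i i] by (simp add: sign_nonneg_def)
qed

lemma sign_nonneg_one_plus_monomial: "0 < m \<Longrightarrow> 0 \<le> c ^ m * a \<Longrightarrow> sign_nonneg c (1 + fps_const a * fps_X ^ m)"
  by (simp add: sign_nonneg_def fps_X_power_iff)

lemma inverse_one_minus_fps_X_power:
  assumes "m > 0"
  shows "inverse (1 - fps_X ^ m) = Abs_fps (\<lambda>n. of_bool (m dvd n) :: 'a::field)"
proof -
  let ?G = "Abs_fps (\<lambda>n. of_bool (m dvd n) :: 'a)"
  have "?G * (1 - fps_X ^ m) = 1"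
  proof (rule fps_ext)
    fix n
    have "fps_nth (?G * (1 - fps_X ^ m)) n = of_bool (m dvd n) - (if n < m then 0 else of_bool (m dvd n - m))"
      by (simp add: algebra_simps fps_X_power_mult_nth)
    also have "\<dots> = fps_nth 1 n"
      using assms by (auto simp: dvd_minus_self dest: nat_dvd_not_less)
    finally show "fps_nth (?G * (1 - fps_X ^ m)) n = fps_nth 1 n" .
  qed
  thus ?thesis by (metis fps_inverse_unique mult.commute)
qed

text \<open>
  For even \<open>m\<close> the expansion of \<open>1 / (1 - q ^ m)\<close> involves only even powers of \<open>q\<close>, to which both signs \<open>c\<close>
  contribute \<open>1\<close>.
\<close>
lemma sign_nonneg_inverse_even:
  fixes c :: "'a::linordered_field"
  assumes "c\<^sup>2 = 1" "even m" "m > 0"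
  shows "sign_nonneg c (inverse (1 - fps_X ^ m))"
proof -
  have "c ^ n = 1" if "m dvd n" for n
    using assms that by (metis dvd_trans dvdE power_mult power_one)
  thus ?thesis using assms(3) by (auto simp: inverse_one_minus_fps_X_power sign_nonneg_def)
qed

text \<open>
  In the Cauchy product the term \<open>f n * g 0\<close> is the coefficient of \<open>f\<close> itself, and the other terms
  have the right sign.
\<close>
lemma sign_nonneg_mult_ge:
  assumes "sign_nonneg c f" "sign_nonneg c g" "fps_nth g 0 = 1"
  shows "c ^ n * fps_nth f n \<le> c ^ n * fps_nth (f * g) n"
proof -
  have "(\<Sum>i\<in>{n}. (c ^ i * fps_nth f i) * (c ^ (n - i) * fps_nth g (n - i))) \<le> c ^ n * fps_nth (f * g) n"
    unfolding signed_fps_mult_nth using assms(1,2)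
    by (intro sum_mono2) (auto simp: sign_nonneg_def)
  thus ?thesis using assms(3) by simp
qed

text \<open>
  Since \<open>c\<^sup>2 = 1\<close>, \<open>1 - q\<^sup>2 = (1 - c * q) * (1 + c * q)\<close>, and hence
  \<open>(1 - c * q) * W = R / (1 - c * q)\<close>. On the left, the signed coefficients are the differences of
  consecutive signed coefficients of \<open>W\<close>, starting with the constant term of \<open>W\<close>; on the right,
  they are at least those of the geometric series, which are all \<open>1\<close>.
\<close>
lemma strict_mono_of_square_factor:
  fixes c :: "'a::linordered_field"
  assumes c: "c\<^sup>2 = 1"
    and W: "W = (1 + fps_const c * fps_X)\<^sup>2 * (inverse (1 - fps_X\<^sup>2))\<^sup>2 * R"
    and R: "sign_nonneg c R" "fps_nth R 0 = 1"
  shows "strict_mono (\<lambda>n. c ^ n * fps_nth W n)" "\<And>n. 0 < c ^ n * fps_nth W n"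
proof -
  define G where "G = Abs_fps (\<lambda>n. c ^ n)"
  have G: "G * (1 - fps_const c * fps_X) = 1"
  proof (rule fps_ext)
    fix n show "fps_nth (G * (1 - fps_const c * fps_X)) n = fps_nth 1 n"
      by (cases n) (simp_all add: G_def algebra_simps)
  qed
  have cn: "c ^ n * c ^ n = 1" for n using c by (simp add: power2_eq_square flip: power_mult_distrib)
  have E: "inverse (1 - fps_X\<^sup>2) * (1 - fps_X\<^sup>2) = (1 :: 'a fps)"
    by (rule inverse_mult_eq_1) simp
  have cc: "fps_const c * fps_const c = 1" using c by (simp add: power2_eq_square)
  have fact: "(1 + fps_const c * fps_X) * (1 - fps_const c * fps_X) = 1 - fps_X\<^sup>2"
    using cc by algebra
  have "W * (1 - fps_const c * fps_X) = G * R"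
    using W G E fact by algebra
  moreover have "sign_nonneg c G" by (simp add: sign_nonneg_def G_def cn)
  ultimately have diff: "1 \<le> c ^ n * fps_nth (W * (1 - fps_const c * fps_X)) n" for n
    using sign_nonneg_mult_ge[of c G R n] R by (simp add: G_def cn)
  have step: "c ^ n * fps_nth W n < c ^ Suc n * fps_nth W (Suc n)" for n
  proof -
    have "c ^ Suc n * fps_nth (W * (1 - fps_const c * fps_X)) (Suc n)
        = c ^ Suc n * fps_nth W (Suc n) - (c * c) * (c ^ n * fps_nth W n)"
      by (simp add: algebra_simps)
    thus ?thesis using diff[of "Suc n"] c by (simp add: power2_eq_square)
  qed
  thus mono: "strict_mono (\<lambda>n. c ^ n * fps_nth W n)" by (simp add: strict_mono_Suc_iff)
  have "1 \<le> c ^ 0 * fps_nth W 0" using diff[of 0] by (simp add: algebra_simps)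
  thus "0 < c ^ n * fps_nth W n" for n
    using strict_mono_mono[OF mono, THEN monoD, of 0 n] by simp
qed

section \<open>Growth of products with a square factor\<close>

definition even_product :: "nat \<Rightarrow> rat fps" where
  "even_product d = (\<Prod>s. inverse (1 - fps_X ^ (2 * Suc s)) ^ d)"

lemma stable_even_factors: "stable_factors (\<lambda>s. inverse (1 - fps_X ^ (2 * Suc s) :: rat fps) ^ d)"
  by (intro stable_factors_power stable_factors_inverse stable_factors_one_minus) simp

text \<open>
  The first factor drives the growth; of the others only the signs and the constant term matter.
  That one \<open>Y\<close> serves both values of \<open>c\<close> is what makes the odd coefficients vanish below.
\<close>
lemma even_product_split:
  obtains Y where "even_product d = inverse (1 - fps_X\<^sup>2) ^ d * Y"
    "\<And>c. c\<^sup>2 = 1 \<Longrightarrow> sign_nonneg c Y" "fps_nth Y 0 = 1"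
proof
  let ?Y = "\<Prod>s. inverse (1 - fps_X ^ (2 * Suc (Suc s)) :: rat fps) ^ d"
  have st: "stable_factors (\<lambda>s. inverse (1 - fps_X ^ (2 * Suc (Suc s)) :: rat fps) ^ d)"
    by (rule stable_factors_Suc[OF stable_even_factors])
  show "even_product d = inverse (1 - fps_X\<^sup>2) ^ d * ?Y"
    unfolding even_product_def using fps_prodinf_split_head[OF stable_even_factors[of d]]
    by (simp add: numeral_2_eq_2)
  show "sign_nonneg c ?Y" if "c\<^sup>2 = 1" for c
    by (intro sign_nonneg_prodinf st sign_nonneg_power sign_nonneg_inverse_even that) auto
  show "fps_nth ?Y 0 = 1" by (rule fps_prodinf_nth_0[OF st])
qed

lemma power_split_square: "2 \<le> m \<Longrightarrow> x ^ m = x\<^sup>2 * (x :: 'a::monoid_mult) ^ (m - 2)"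
  by (metis le_add_diff_inverse power_add)

lemma fps_power_nth_2:
  fixes f :: "'a::comm_ring_1 fps"
  assumes "fps_nth f 0 = 1" "fps_nth f 1 = 0"
  shows "fps_nth (f ^ n) 2 = of_nat n * fps_nth f 2"
proof (induction n)
  case (Suc n)
  have "fps_nth (f * f ^ n) 2 = fps_nth (f ^ n) 2 + fps_nth f 2 * fps_nth (f ^ n) 0"
    using assms by (simp add: fps_mult_nth numeral_2_eq_2)
  thus ?case using Suc assms by (simp add: algebra_simps fps_nth_power_0)
qed simp

text \<open>
  The coefficients are nonnegative for both signs \<open>c = 1\<close> and \<open>c = - 1\<close>, which forces the odd ones
  to vanish. For the growth, \<open>(1 - q\<^sup>2) * W\<close> collects the differences of coefficients two apart; it
  still has a factor \<open>1 / (1 - q\<^sup>2)\<close>, so its even coefficients are at least \<open>1\<close>.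
\<close>
lemma even_product_growth:
  assumes "2 \<le> d"
  shows "odd n \<Longrightarrow> fps_nth (even_product d) n = 0"
    and "strict_mono (\<lambda>n. fps_nth (even_product d) (2 * n))"
    and "fps_nth (even_product d) 0 = 1"
    and "fps_nth (even_product d) 2 = of_nat d"
proof -
  let ?E = "inverse (1 - fps_X\<^sup>2) :: rat fps" and ?W = "even_product d"
  obtain Y where Y: "?W = ?E ^ d * Y" "\<And>c. c\<^sup>2 = 1 \<Longrightarrow> sign_nonneg c Y" "fps_nth Y 0 = 1"
    using even_product_split[of d] by metis
  have nonneg: "sign_nonneg c ?W" if "c\<^sup>2 = 1" for c
    unfolding Y(1) using that
    by (intro sign_nonneg_mult sign_nonneg_power sign_nonneg_inverse_even Y) auto
  show "fps_nth ?W n = 0" if "odd n"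
  proof -
    have "0 \<le> 1 ^ n * fps_nth ?W n" "0 \<le> (-1) ^ n * fps_nth ?W n"
      using nonneg[of 1] nonneg[of "-1"] unfolding sign_nonneg_def by simp_all
    thus ?thesis using that by simp
  qed
  show "fps_nth ?W 0 = 1"
    unfolding even_product_def by (rule fps_prodinf_nth_0[OF stable_even_factors])
  have E: "fps_nth ?E n = of_bool (even n)" for n by (simp add: inverse_one_minus_fps_X_power)
  \<comment> \<open>Factors beyond the first differ from \<open>1\<close> only from \<open>q ^ 4\<close> on.\<close>
  have "fps_nth ?W 2 = fps_nth (?E ^ d) 2"
  proof -
    have "fps_nth ?W 2 = fps_nth (?E ^ d * inverse (1 - fps_X ^ 4) ^ d) 2"
    proof -
      have "{..<2} = {0, 1 :: nat}" by auto
      thus ?thesis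
        unfolding even_product_def using fps_prodinf_nth[OF stable_even_factors, of 2 2 d]
        by (simp del: power_Suc flip: numeral_2_eq_2)
    qed
    also have "\<dots> = fps_nth (?E ^ d * 1) 2"
    proof (rule fps_mult_nth_cong)
      have F: "fps_nth (inverse (1 - fps_X ^ 4) :: rat fps) j = fps_nth 1 j" if "j \<le> 2" for j
        using that by (auto simp: inverse_one_minus_fps_X_power dest: dvd_imp_le)
      hence "fps_nth (inverse (1 - fps_X ^ 4) ^ d :: rat fps) 2 = 0"
        using fps_power_nth_2[of "inverse (1 - fps_X ^ 4) :: rat fps" d] by simp
      thus "fps_nth (inverse (1 - fps_X ^ 4) ^ d :: rat fps) j = fps_nth 1 j" if "j \<le> 2" for j
      proof -
        have "j = 0 \<or> j = 1 \<or> j = 2" using that by arith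
        thus ?thesis
          using F[of 0] F[of 1] \<open>fps_nth (inverse (1 - fps_X ^ 4) ^ d) 2 = 0\<close>
          by (elim disjE) (simp_all add: fps_nth_power_0 fps_power_first[unfolded One_nat_def])
      qed
    qed simp
    finally show ?thesis by simp
  qed
  also have "\<dots> = of_nat d" using fps_power_nth_2[of ?E d] by (simp add: E)
  finally show "fps_nth ?W 2 = of_nat d" .
  define R where "R = ?E ^ (d - 2) * Y"
  have R: "sign_nonneg 1 R" "fps_nth R 0 = 1"
    unfolding R_def using Y
    by (auto intro!: sign_nonneg_mult sign_nonneg_power sign_nonneg_inverse_even simp: fps_nth_power_0)
  have "?W = ?E * (?E * R)"
    unfolding Y(1) R_def power_split_square[OF assms, of ?E] by (simp only: power2_eq_square mult.assoc)
  moreover have "?E * (1 - fps_X\<^sup>2) = 1" by (rule inverse_mult_eq_1) simp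
  ultimately have W: "?W * (1 - fps_X\<^sup>2) = ?E * R" by algebra
  show "strict_mono (\<lambda>n. fps_nth ?W (2 * n))"
    unfolding strict_mono_Suc_iff
  proof
    fix n
    have "fps_nth (?W * (1 - fps_X\<^sup>2)) (Suc (Suc (2 * n)))
        = fps_nth ?W (2 * Suc n) - fps_nth ?W (2 * n)"
      by (simp add: algebra_simps fps_X_power_mult_right_nth)
    moreover have "1 \<le> fps_nth (?E * R) (Suc (Suc (2 * n)))"
      using sign_nonneg_mult_ge[of 1 ?E R "Suc (Suc (2 * n))"] sign_nonneg_inverse_even[of 1 2] R
      by (simp add: E)
    ultimately show "fps_nth ?W (2 * n) < fps_nth ?W (2 * Suc n)" by (simp add: W)
  qed
qed

text \<open>
  The common form of the generating series for the two signs of the Euler characteristic: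
  \<open>k n = n + 1\<close> with \<open>c = 1\<close>, and \<open>k n = 2 * n + 1\<close> with \<open>c = - 1\<close>. The condition on
  \<open>c ^ k n * c\<close> says that each exponent \<open>k n\<close> is odd when \<open>c = - 1\<close>, which is what gives every
  factor coefficients of the right sign. The exponents \<open>a\<close> and \<open>d\<close> must be at least \<open>2\<close> for the
  squares in \<open>strict_mono_of_square_factor\<close> to split off.
\<close>
lemma signed_product_growth:
  fixes c :: rat and k :: "nat \<Rightarrow> nat"
  assumes c: "c\<^sup>2 = 1" and k: "k 0 = 1" "\<And>n. n < k n" and pos: "\<And>n. 0 \<le> c ^ k n * c"
    and ad: "2 \<le> a" "2 \<le> d"
    and W: "W = (\<Prod>n. (1 + fps_const c * fps_X ^ k n) ^ a) * even_product d"
  shows "strict_mono (\<lambda>n. c ^ n * fps_nth W n)" "\<And>n. 0 < c ^ n * fps_nth W n"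
    "c * fps_nth W 1 = of_nat a"
proof -
  obtain Y where Y: "even_product d = inverse (1 - fps_X\<^sup>2) ^ d * Y" "sign_nonneg c Y" "fps_nth Y 0 = 1"
    using even_product_split[of d] c by metis
  have st: "stable_factors (\<lambda>n. (1 + fps_const c * fps_X ^ k n) ^ a)"
    by (intro stable_factors_power stable_factors_one_plus_monomial k)
  define Z where "Z = (\<Prod>n. (1 + fps_const c * fps_X ^ k (Suc n)) ^ a)"
  have Z: "sign_nonneg c Z" "fps_nth Z 0 = 1"
    unfolding Z_def using stable_factors_Suc[OF st]
    by (auto intro!: sign_nonneg_prodinf fps_prodinf_nth_0 sign_nonneg_power sign_nonneg_one_plus_monomial pos
        intro: le_less_trans[OF _ k(2)])
  have Zsplit: "(\<Prod>n. (1 + fps_const c * fps_X ^ k n) ^ a) = (1 + fps_const c * fps_X) ^ a * Z"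
    unfolding Z_def using fps_prodinf_split_head[OF st] k by simp
  define R where "R = (1 + fps_const c * fps_X) ^ (a - 2) * Z * inverse (1 - fps_X\<^sup>2) ^ (d - 2) * Y"
  have "W = (1 + fps_const c * fps_X)\<^sup>2 * (inverse (1 - fps_X\<^sup>2))\<^sup>2 * R"
    unfolding W Zsplit Y(1) R_def
    using power_split_square[OF ad(1), of "1 + fps_const c * fps_X"]
      power_split_square[OF ad(2), of "inverse (1 - fps_X\<^sup>2) :: rat fps"]
    by (simp only: mult_ac)
  moreover have "sign_nonneg c R"
    unfolding R_def using c Y Z sign_nonneg_one_plus_monomial[of 1 c c]
    by (intro sign_nonneg_mult sign_nonneg_power sign_nonneg_inverse_even) (auto simp: power2_eq_square)
  moreover have "fps_nth R 0 = 1" using Y Z by (simp add: R_def fps_nth_power_0)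
  ultimately show "strict_mono (\<lambda>n. c ^ n * fps_nth W n)" "\<And>n. 0 < c ^ n * fps_nth W n"
    using strict_mono_of_square_factor[OF c] by blast+
  have "fps_nth (even_product d) 0 = 1" "fps_nth (even_product d) 1 = 0"
    using even_product_growth[OF ad(2)] by simp_all
  moreover have "fps_nth (\<Prod>n. (1 + fps_const c * fps_X ^ k n) ^ a) i = fps_nth ((1 + fps_const c * fps_X) ^ a) i"
    if "i \<le> 1" for i
    using fps_prodinf_nth[OF st that] k by simp
  ultimately have "fps_nth W 1 = of_nat a * c"
    unfolding W by (simp add: fps_nth_power_0 fps_power_first[unfolded One_nat_def])
  thus "c * fps_nth W 1 = of_nat a" using c by (simp add: power2_eq_square)
qed

section \<open>Monotonicity of the signed counts\<close>

lemma fps_one_divide_powi: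
  fixes f :: "'a::field fps"
  assumes "fps_nth f 0 \<noteq> 0"
  shows "0 \<le> e \<Longrightarrow> 1 / f powi e = inverse f ^ nat e" and "e \<le> 0 \<Longrightarrow> 1 / f powi e = f ^ nat (- e)"
proof -
  have divide: "1 / g ^ n = inverse g ^ n" if "fps_nth g 0 \<noteq> 0" for g :: "'a fps" and n
    using that by (simp add: fps_divide_unit fps_nth_power_0 fps_inverse_power)
  show "1 / f powi e = inverse f ^ nat e" if "0 \<le> e"
    using divide[OF assms] that by (simp add: power_int_def)
  show "1 / f powi e = f ^ nat (- e)" if "e \<le> 0"
  proof (cases "e = 0")
    case False
    hence "1 / f powi e = 1 / inverse f ^ nat (- e)" using that by (simp add: power_int_def)
    also have "\<dots> = inverse (inverse f) ^ nat (- e)" by (rule divide) (use assms in simp)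
    finally show ?thesis by (simp only: fps_inverse_idempotent[OF assms])
  qed simp
qed

lemma even_product_eq:
  assumes "0 \<le> d"
  shows "(\<Prod>s. 1 / (1 - fps_X ^ (2 * Suc s)) powi d) = even_product (nat d)"
  unfolding even_product_def by (subst fps_one_divide_powi(1)) (use assms in simp_all)

lemma welschinger_series_nonneg:
  assumes "0 \<le> e" "e \<le> 24"
  shows "welschinger_series e =
    (\<Prod>n. (1 - fps_X ^ (2 * n + 1)) ^ nat e) * even_product (nat ((24 - e) div 2))"
proof -
  have "(\<Prod>r. 1 / (1 + fps_X ^ Suc r) powi e) = (\<Prod>r. inverse (1 + fps_X ^ Suc r :: rat fps) ^ nat e)"
    by (subst fps_one_divide_powi(1)) (use assms in simp_all)
  also have "\<dots> = (\<Prod>r. inverse (1 + fps_X ^ Suc r)) ^ nat e"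
    by (intro fps_prodinf_power stable_factors_inverse stable_factors_one_plus) simp
  also have "\<dots> = (\<Prod>n. 1 - fps_X ^ (2 * n + 1)) ^ nat e"
    by (simp only: prodinf_inverse_one_plus_fps_X_power)
  also have "\<dots> = (\<Prod>n. (1 - fps_X ^ (2 * n + 1)) ^ nat e)"
    by (intro fps_prodinf_power[symmetric] stable_factors_one_minus) simp
  finally show ?thesis
    unfolding welschinger_series_def e_complex_def using assms by (subst even_product_eq) auto
qed

lemma welschinger_series_nonpos:
  assumes "e \<le> 0"
  shows "welschinger_series e =
    (\<Prod>n. (1 + fps_X ^ Suc n) ^ nat (- e)) * even_product (nat ((24 - e) div 2))"
proof -
  have "1 / (1 + fps_X ^ Suc r :: rat fps) powi e = (1 + fps_X ^ Suc r) ^ nat (- e)" for r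
    by (rule fps_one_divide_powi(2)) (use assms in simp_all)
  thus ?thesis
    unfolding welschinger_series_def e_complex_def using assms by (simp only: even_product_eq)
qed

theorem theorem2p1:
  fixes e :: int
  assumes "even e" and "-18 \<le> e" and "e \<le> 20"
  shows
    "(e < 0 \<longrightarrow>
        (\<forall>g. welschinger_count e g > 0) \<and>
        welschinger_count e 1 = of_int \<bar>e\<bar> \<and>
        strict_mono_on {1..} (welschinger_count e)) \<and>
     (e = 0 \<longrightarrow>
        (\<forall>g. odd g \<longrightarrow> welschinger_count e g = 0) \<and>
        (\<forall>g. even g \<longrightarrow> welschinger_count e g > 0) \<and>
        welschinger_count e 2 = 12 \<and>
        strict_mono_on {g. even g \<and> g \<ge> 2} (welschinger_count e)) \<and>
     (e > 0 \<longrightarrow>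
        (\<forall>g. (-1) ^ g * welschinger_count e g > 0) \<and>
        - welschinger_count e 1 = of_int e \<and>
        strict_mono_on {1..} (\<lambda>g. (-1) ^ g * welschinger_count e g))"
proof (rule conjI[OF impI conjI[OF impI impI]])
  assume neg: "e < 0"
  have a: "2 \<le> nat (- e)" proof -
    have "e \<le> - 2" using neg assms(1) by presburger
    thus ?thesis by simp
  qed
  have d: "2 \<le> nat ((24 - e) div 2)" using neg by simp
  have W: "welschinger_series e = (\<Prod>n. (1 + fps_const 1 * fps_X ^ Suc n) ^ nat (- e))
      * even_product (nat ((24 - e) div 2))"
    using welschinger_series_nonpos neg by simp
  have "strict_mono (welschinger_count e)" "\<And>g. 0 < welschinger_count e g"
    "welschinger_count e 1 = of_nat (nat (- e))"
    using signed_product_growth[OF _ _ _ _ a d W] by (simp_all add: welschinger_count_def[abs_def])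
  thus "(\<forall>g. welschinger_count e g > 0) \<and> welschinger_count e 1 = of_int \<bar>e\<bar> \<and>
      strict_mono_on {1..} (welschinger_count e)"
    using neg monotone_on_subset[of UNIV] by simp
next
  assume zero: "e = 0"
  have W: "welschinger_count e = fps_nth (even_product 12)"
    using welschinger_series_nonpos[of e] zero
    by (simp add: welschinger_count_def fun_eq_iff fps_prodinf_one)
  have mono: "strict_mono (\<lambda>n. fps_nth (even_product 12) (2 * n))" by (rule even_product_growth) simp
  have pos: "0 < fps_nth (even_product 12) (2 * n)" for n
    using strict_mono_mono[OF mono, THEN monoD, of 0 n] even_product_growth(3)[of 12] by simp
  show "(\<forall>g. odd g \<longrightarrow> welschinger_count e g = 0) \<and> (\<forall>g. even g \<longrightarrow> welschinger_count e g > 0) \<and>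
      welschinger_count e 2 = 12 \<and> strict_mono_on {g. even g \<and> g \<ge> 2} (welschinger_count e)"
    unfolding W
  proof (intro conjI allI impI)
    show "strict_mono_on {g. even g \<and> g \<ge> 2} (fps_nth (even_product 12))"
    proof (rule strict_mono_onI)
      fix g h :: nat
      assume "g \<in> {g. even g \<and> g \<ge> 2}" "h \<in> {g. even g \<and> g \<ge> 2}" "g < h"
      then obtain m n where "g = 2 * m" "h = 2 * n" "m < n" by (auto elim!: evenE)
      thus "fps_nth (even_product 12) g < fps_nth (even_product 12) h"
        using strict_monoD[OF mono] by simp
    qed
    show "0 < fps_nth (even_product 12) g" if "even g" for g using that pos by (metis evenE)
  qed (use even_product_growth[of 12] in simp_all)
next
  assume pos: "e > 0"
  have a: "2 \<le> nat e" proof -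
    have "2 \<le> e" using pos assms(1) by presburger
    thus ?thesis by simp
  qed
  have d: "2 \<le> nat ((24 - e) div 2)" using assms(3) by simp
  have W: "welschinger_series e = (\<Prod>n. (1 + fps_const (- 1) * fps_X ^ (2 * n + 1)) ^ nat e)
      * even_product (nat ((24 - e) div 2))"
    using welschinger_series_nonneg pos assms(3) by (simp flip: fps_const_neg)
  have "strict_mono (\<lambda>g. (-1) ^ g * welschinger_count e g)" "\<And>g. 0 < (-1) ^ g * welschinger_count e g"
    "- welschinger_count e 1 = of_nat (nat e)"
    using signed_product_growth[OF _ _ _ _ a d W] by (simp_all add: welschinger_count_def)
  thus "(\<forall>g. (-1) ^ g * welschinger_count e g > 0) \<and> - welschinger_count e 1 = of_int e \<and>
      strict_mono_on {1..} (\<lambda>g. (-1) ^ g * welschinger_count e g)"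
    using pos monotone_on_subset[of UNIV] by simp
qed

end
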